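(* Assume that $$\{\bm{v}^\top\in\mathbb{R}^m_+\mid \bm{v}P\le\bm{0}\}\subseteq\mathbb{R}^m_{++}\cup\{\bm{0}\}\quad\text{and}\quad \emptyset\ne\{\bm{u}^\top\in\mathbb{R}^s_+\mid \bm{u}Q\le\bm{0},\ \bm{u}\ne\bm{0}\}\subseteq\mathbb{R}^s_{++}.$$ Then for each $(\bm{x},\bm{y})\in T\cap\mathbb{R}^{m+s}_{++}$, $$D^-(\bm{x},\bm{y})=\min\Big\{\sum_{i=1}^m\frac{d_i^-}{x_i}\ \Big|\ (\bm{x}-\bm{d}^-,\bm{y})\in\partial^w(T),\ \bm{d}^-\ge\bm{0}\Big\}=\min_{i=1,\dots,m}\max\{\delta\mid(\bm{x}-\delta x_i\bm{e}_i,\bm{y})\in T\}$$ and $$D^+(\bm{x},\bm{y})=\min\Big\{\sum_{r=1}^s\frac{d_r^+}{y_r}\ \Big|\ (\bm{x},\bm{y}+\bm{d}^+)\in\partial^w(T),\ \bm{d}^+\ge\bm{0}\Big\}=\min_{r=1,\dots,s}\max\{\delta\mid(\bm{x},\bm{y}+\delta y_r\bm{e}_r)\in T\},$$ where $\bm{e}_i$ denotes the $i$th unit vector (of $\mathbb{R}^m$) and $\bm{e}_r$ the $r$th unit vector (of $\mathbb{R}^s$).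
   Context: There are $n$ decision making units; unit $j$ has input vector $\bm{x}_j\in\mathbb{R}^m$ and output vector $\bm{y}_j\in\mathbb{R}^s$, with $(\bm{x}_j,\bm{y}_j)\in\mathbb{R}^{m+s}_{++}$ for all $j=1,\dots,n$. $P$ is a given real matrix with $m$ rows and $Q$ a given real matrix with $s$ rows. $\mathbb{R}^L_+$ and $\mathbb{R}^L_{++}$ denote vectors with all entries nonnegative, respectively strictly positive; $\bm{v},\bm{u}$ are row vectors. Vector inequalities are componentwise ($>$ means strict in every component). The production possibility set is $$T=\Big\{(\bm{x},\bm{y})\in\mathbb{R}^m\times\mathbb{R}^s\ \Big|\ \sum_{j=1}^n\lambda_j\bm{x}_j-P\bm{\alpha}\le\bm{x},\ \sum_{j=1}^n\lambda_j\bm{y}_j+Q\bm{\beta}\ge\bm{y}\ \text{ for some }\bm{\lambda}\ge\bm{0},\bm{\alpha}\ge\bm{0},\bm{\beta}\ge\bm{0}\Big\}.$$ The strongly efficient frontier $\partial^s(T)$ is the set of $(\bm{x},\bm{y})\in T$ such that whenever $(\bm{x},-\bm{y})\ge(\bm{x}',-\bm{y}')$ and $(\bm{x},-\bm{y})\ne(\bm{x}',-\bm{y}')$, one has $(\bm{x}',\bm{y}')\notin T$. The weakly efficient frontier $\partial^w(T)$ is the set of $(\bm{x},\bm{y})\in T$ such that whenever $(\bm{x},-\bm{y})>(\bm{x}',-\bm{y}')$, one has $(\bm{x}',\bm{y}')\notin T$. The least distance inefficiency measures are $$D^-(\bm{x},\bm{y})=\min\Big\{\sum_{i=1}^m\frac{d_i^-}{x_i}\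 \Big|\ (\bm{x}-\bm{d}^-,\bm{y})\in\partial^s(T),\ \bm{d}^-\ge\bm{0}\Big\},\qquad D^+(\bm{x},\bm{y})=\min\Big\{\sum_{r=1}^s\frac{d_r^+}{y_r}\ \Big|\ (\bm{x},\bm{y}+\bm{d}^+)\in\partial^s(T),\ \bm{d}^+\ge\bm{0}\Big\}.$$
   Formalization: The minima and maxima are claimed to be attained only if some nonzero v ≥ 0 satisfies vP ≤ 0; otherwise T is the whole space, both frontiers are empty, and the equalities are read with min ∅ = +∞ and max of an unbounded set = +∞. *)

theory Defs
  imports "HOL-Analysis.Analysis"
begin

text \<open>The library order on vectors is componentwise, but its strict part only asks for
  \<open>x \<le> y\<close> and \<open>x \<noteq> y\<close>. The strict relation needed here is strict in every component.\<close>

definition vec_less :: "real ^ 'k \<Rightarrow> real ^ 'k \<Rightarrow> bool"  (infix "\<lless>" 50)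
  where "x \<lless> y \<longleftrightarrow> (\<forall>i. x $ i < y $ i)"

definition technology ::
  "('n::finite \<Rightarrow> real ^ 'm) \<Rightarrow> ('n \<Rightarrow> real ^ 's) \<Rightarrow> real ^ 'p ^ 'm \<Rightarrow> real ^ 'q ^ 's
    \<Rightarrow> ((real ^ 'm) \<times> (real ^ 's)) set"
  where "technology X Y P Q =
    {(x, y). \<exists>(l :: real ^ 'n) a b. 0 \<le> l \<and> 0 \<le> a \<and> 0 \<le> b \<and>
       (\<Sum>j\<in>UNIV. (l $ j) *\<^sub>R X j) - P *v a \<le> x \<and>
       y \<le> (\<Sum>j\<in>UNIV. (l $ j) *\<^sub>R Y j) + Q *v b}"

definition strong_frontier ::
  "((real ^ 'm) \<times> (real ^ 's)) set \<Rightarrow> ((real ^ 'm) \<times> (real ^ 's)) set"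
  where "strong_frontier T =
    {(x, y). (x, y) \<in> T \<and>
       (\<forall>x' y'. (x', - y') \<le> (x, - y) \<and> (x', - y') \<noteq> (x, - y) \<longrightarrow> (x', y') \<notin> T)}"

definition weak_frontier ::
  "((real ^ 'm) \<times> (real ^ 's)) set \<Rightarrow> ((real ^ 'm) \<times> (real ^ 's)) set"
  where "weak_frontier T =
    {(x, y). (x, y) \<in> T \<and>
       (\<forall>x' y'. x' \<lless> x \<and> - y' \<lless> - y \<longrightarrow> (x', y') \<notin> T)}"

definition input_slacks ::
  "((real ^ 'm) \<times> (real ^ 's)) set \<Rightarrow> real ^ 'm \<Rightarrow> real ^ 's \<Rightarrow> (real ^ 'm) set"
  where "input_slacks F x y = {d. (x - d, y) \<in> F \<and> 0 \<le> d}"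

definition output_slacks ::
  "((real ^ 'm) \<times> (real ^ 's)) set \<Rightarrow> real ^ 'm \<Rightarrow> real ^ 's \<Rightarrow> (real ^ 's) set"
  where "output_slacks F x y = {d. (x, y + d) \<in> F \<and> 0 \<le> d}"

definition rel_size :: "real ^ 'k \<Rightarrow> real ^ 'k \<Rightarrow> real"
  where "rel_size z d = (\<Sum>i\<in>UNIV. d $ i / z $ i)"

text \<open>Minima and maxima are taken in the extended reals: the minimum over the empty set is
  \<open>\<infinity>\<close>, and so is the maximum of a set that is unbounded above. Infimum and supremum do not
  express attainment, which therefore has to be asserted separately.\<close>

definition min_input_distance ::
  "((real ^ 'm) \<times> (real ^ 's)) set \<Rightarrow> real ^ 'm \<Rightarrow> real ^ 's \<Rightarrow> ereal"
  where "min_input_distance F x y = (INF d\<in>input_slacks F x y. ereal (rel_size x d))"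

definition min_output_distance ::
  "((real ^ 'm) \<times> (real ^ 's)) set \<Rightarrow> real ^ 'm \<Rightarrow> real ^ 's \<Rightarrow> ereal"
  where "min_output_distance F x y = (INF d\<in>output_slacks F x y. ereal (rel_size y d))"

definition D_minus :: "((real ^ 'm) \<times> (real ^ 's)) set \<Rightarrow> real ^ 'm \<Rightarrow> real ^ 's \<Rightarrow> ereal"
  where "D_minus T x y = min_input_distance (strong_frontier T) x y"

definition D_plus :: "((real ^ 'm) \<times> (real ^ 's)) set \<Rightarrow> real ^ 'm \<Rightarrow> real ^ 's \<Rightarrow> ereal"
  where "D_plus T x y = min_output_distance (strong_frontier T) x y"

definition input_steps ::
  "((real ^ 'm) \<times> (real ^ 's)) set \<Rightarrow> real ^ 'm \<Rightarrow> real ^ 's \<Rightarrow> 'm \<Rightarrow> real set"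
  where "input_steps T x y i = {\<delta>. (x - (\<delta> * x $ i) *\<^sub>R axis i 1, y) \<in> T}"

definition output_steps ::
  "((real ^ 'm) \<times> (real ^ 's)) set \<Rightarrow> real ^ 'm \<Rightarrow> real ^ 's \<Rightarrow> 's \<Rightarrow> real set"
  where "output_steps T x y r = {\<delta>. (x, y + (\<delta> * y $ r) *\<^sub>R axis r 1) \<in> T}"

definition attains_min :: "('a \<Rightarrow> real) \<Rightarrow> 'a set \<Rightarrow> bool"
  where "attains_min f A \<longleftrightarrow> (\<exists>a\<in>A. \<forall>b\<in>A. f a \<le> f b)"

definition has_max :: "real set \<Rightarrow> bool"
  where "has_max A \<longleftrightarrow> (\<exists>a\<in>A. \<forall>b\<in>A. b \<le> a)"

end

theory Submission
  imports Defs
begin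

text \<open>Prices carry the argument. Call \<open>(v, u) \<ge> 0\<close> no-profit prices if
  \<open>u \<bullet> y \<le> v \<bullet> x\<close> for all \<open>(x, y) \<in> T\<close>. Since \<open>T\<close> is a convex cone closed under wasting inputs and
  outputs, separating it from the points that strictly dominate a weakly efficient \<open>(x, y)\<close> gives
  nonzero no-profit prices at which \<open>(x, y)\<close> breaks even (\<open>weak_frontier_supporting_prices\<close>).
  No-profit prices satisfy \<open>v v* P \<le> 0\<close> and \<open>u v* Q \<le> 0\<close>, so the two cone conditions make each of
  \<open>v\<close> and \<open>u\<close> either zero or strictly positive, and \<open>y > 0\<close> rules out zero
  (\<open>weak_frontier_strictly_positive_prices\<close>). A point that breaks even at strictly positive prices
  is strongly efficient, because any improvement of it would make a profit (\<open>strong_frontierI\<close>).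
  Hence the strong and the weak frontier coincide where outputs are positive, which settles the
  first equality for both distances.

  For the second equality, fix one side, say inputs. A slack \<open>d\<close> on the frontier maximizes
  \<open>w \<bullet> d\<close> over all feasible slacks for some \<open>w > 0\<close>, namely for the input prices \<open>w = v\<close>. Let the
  step \<open>\<delta>\<^sub>i\<close> be the largest feasible relative reduction of input \<open>i\<close> alone. Going \<open>\<delta>\<^sub>i\<close> in direction
  \<open>i\<close> ends on the frontier and has relative size \<open>\<delta>\<^sub>i\<close>, so the distance is at most
  every \<open>\<delta>\<^sub>i\<close>. Conversely, if \<open>i\<close> maximizes \<open>w\<^sub>i x\<^sub>i\<close>, then
  \<open>w\<^sub>i x\<^sub>i \<delta>\<^sub>i \<le> w \<bullet> d = \<Sum>\<^sub>k w\<^sub>k x\<^sub>k (d\<^sub>k / x\<^sub>k) \<le> w\<^sub>i x\<^sub>i \<Sum>\<^sub>k d\<^sub>k / x\<^sub>k\<close>, so every frontier slack costs at least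
  one of the \<open>\<delta>\<^sub>i\<close>. The locale \<open>slack_region\<close> does this once for both sides. That the \<open>\<delta>\<^sub>i\<close> are attained
  rests on the closedness of \<open>T\<close>, a finitely generated cone, and on the existence of some strictly positive
  no-profit prices.

  Such prices exist as soon as some \<open>v \<ge> 0\<close>, \<open>v \<noteq> 0\<close> has \<open>v v* P \<le> 0\<close>. Otherwise separation shows that
  \<open>T\<close> is the whole space (\<open>technology_eq_UNIV\<close>): both frontiers are empty, the steps are unbounded,
  and every quantity in the equalities is \<open>\<infinity>\<close>.\<close>

section \<open>Componentwise order and scalar products\<close>

lemma inner_nonneg:
  fixes v z :: "real ^ 'k"
  assumes "0 \<le> v" "0 \<le> z"
  shows "0 \<le> v \<bullet> z"
  using assms unfolding inner_vec_def less_eq_vec_def by (auto intro!: sum_nonneg)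

lemma inner_pos:
  fixes v z :: "real ^ 'k"
  assumes "0 \<lless> v" "0 \<le> z" "z \<noteq> 0"
  shows "0 < v \<bullet> z"
proof -
  obtain i where "z $ i \<noteq> 0" using assms(3) by (auto simp: vec_eq_iff)
  with assms(2) have "0 < z $ i" by (simp add: less_eq_vec_def order_less_le)
  with assms show ?thesis
    unfolding inner_vec_def vec_less_def less_eq_vec_def
    by (intro sum_pos2[where i = i]) (auto simp: less_imp_le)
qed

lemma vec_less_imp_le: "x \<lless> y \<Longrightarrow> x \<le> y"
  by (auto simp: vec_less_def less_eq_vec_def intro: less_imp_le)

lemma vec_less_imp_neq: "x \<lless> y \<Longrightarrow> x \<noteq> y"
  by (auto simp: vec_less_def)

lemma vec_less_le_trans: "x \<lless> y \<Longrightarrow> y \<le> z \<Longrightarrow> x \<lless> z"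
  unfolding vec_less_def less_eq_vec_def by (meson less_le_trans)

lemma axis_nonneg: "0 \<le> (axis i 1 :: real ^ 'k)"
  by (simp add: less_eq_vec_def axis_def)

lemma inner_axis_one: "axis i (1 :: real) \<bullet> z = z $ i"
  by (simp add: inner_axis')

lemma nonneg_if_inner_nonneg:
  fixes v :: "real ^ 'k"
  assumes "\<And>z. 0 \<le> z \<Longrightarrow> 0 \<le> v \<bullet> z"
  shows "0 \<le> v"
  using assms[OF axis_nonneg] by (simp add: less_eq_vec_def inner_axis)

section \<open>The technology as a closed convex cone\<close>

lemma nonneg_orthant_eq_convex_cone_hull:
  "{z :: 'a :: ordered_euclidean_space. 0 \<le> z} = convex_cone hull Basis"
proof (rule hull_unique[symmetric])
  show "Basis \<subseteq> {z :: 'a. 0 \<le> z}" by (auto simp: eucl_le[where 'a='a] inner_Basis)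
  show "convex_cone {z :: 'a. 0 \<le> z}"
    by (auto simp: convex_cone_iff scaleR_nonneg_nonneg)
next
  fix C :: "'a set"
  assume C: "Basis \<subseteq> C" "convex_cone C"
  show "{z. 0 \<le> z} \<subseteq> C"
  proof clarify
    fix z :: 'a assume "0 \<le> z"
    then have z: "0 \<le> z \<bullet> b" if "b \<in> Basis" for b using that by (simp add: eucl_le[where 'a='a])
    have "(\<Sum>b\<in>B. (z \<bullet> b) *\<^sub>R b) \<in> C" if "finite B" "B \<subseteq> Basis" for B
      using that
    proof (induction B rule: finite_induct)
      case empty
      then show ?case using convex_cone_contains_0[OF C(2)] by simp
    next
      case (insert b B)
      then show ?case
        using C z by (auto intro!: convex_cone_add convex_cone_scaleR)
    qed
    then show "z \<in> C" using euclidean_representation[of z] finite_Basis by (metis order_refl)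
  qed
qed

text \<open>Convexity and closedness are read off from finite generation: the image is the convex cone
  generated by the images of the basis vectors. A linear image of a closed cone need not
  be closed in general.\<close>

lemma convex_cone_linear_image_orthant:
  fixes f :: "'a :: ordered_euclidean_space \<Rightarrow> 'b :: euclidean_space"
  assumes "linear f"
  shows "convex_cone (f ` {z. 0 \<le> z})" and "closed (f ` {z. 0 \<le> z})"
proof -
  have "f ` {z. 0 \<le> z} = convex_cone hull (f ` Basis)"
    by (simp add: nonneg_orthant_eq_convex_cone_hull convex_cone_hull_linear_image[OF assms])
  then show "convex_cone (f ` {z. 0 \<le> z})" "closed (f ` {z. 0 \<le> z})"
    by (simp_all add: convex_cone_convex_cone_hull closed_convex_cone_hull)
qed

text \<open>Nonnegative slack variables \<open>s\<close>, \<open>t\<close> turn the defining inequalities into equations, so that a point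
  depends linearly on the nonnegative vector of intensities, matrix multipliers and slacks.\<close>

lemma technology_eq_linear_image:
  fixes X :: "'n::finite \<Rightarrow> real ^ 'm" and Y :: "'n \<Rightarrow> real ^ 's"
    and P :: "real ^ 'p ^ 'm" and Q :: "real ^ 'q ^ 's"
  shows "\<exists>f :: (real ^ 'n) \<times> (real ^ 'p) \<times> (real ^ 'q) \<times> (real ^ 'm) \<times> (real ^ 's)
            \<Rightarrow> (real ^ 'm) \<times> (real ^ 's).
           linear f \<and> technology X Y P Q = f ` {z. 0 \<le> z}"
proof -
  define f :: "(real ^ 'n) \<times> (real ^ 'p) \<times> (real ^ 'q) \<times> (real ^ 'm) \<times> (real ^ 's)
      \<Rightarrow> (real ^ 'm) \<times> (real ^ 's)"
    where "f = (\<lambda>(l, a, b, s, t). ((\<Sum>j\<in>UNIV. (l $ j) *\<^sub>R X j) - P *v a + s,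
                                 (\<Sum>j\<in>UNIV. (l $ j) *\<^sub>R Y j) + Q *v b - t))"
  have "linear f"
    by (rule linearI)
      (auto simp: f_def split: prod.splits
        simp: matrix_vector_right_distrib sum.distrib scaleR_add_left scaleR_sum_right
          matrix_vector_mult_scaleR algebra_simps)
  moreover have "technology X Y P Q = f ` {z. 0 \<le> z}"
  proof (intro set_eqI iffI)
    fix p assume "p \<in> technology X Y P Q"
    then obtain x y l a b where p: "p = (x, y)" and "0 \<le> l" "0 \<le> a" "0 \<le> b"
      and "(\<Sum>j\<in>UNIV. (l $ j) *\<^sub>R X j) - P *v a \<le> x" "y \<le> (\<Sum>j\<in>UNIV. (l $ j) *\<^sub>R Y j) + Q *v b"
      unfolding technology_def by blast
    then show "p \<in> f ` {z. 0 \<le> z}"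
      by (intro image_eqI[of _ _ "(l, a, b, x - ((\<Sum>j\<in>UNIV. (l $ j) *\<^sub>R X j) - P *v a),
            (\<Sum>j\<in>UNIV. (l $ j) *\<^sub>R Y j) + Q *v b - y)"])
        (auto simp: f_def less_eq_prod_def zero_prod_def less_eq_vec_def)
  next
    fix p assume "p \<in> f ` {z. 0 \<le> z}"
    then obtain l a b s t where "0 \<le> l" "0 \<le> a" "0 \<le> b" "0 \<le> s" "0 \<le> t"
      and "p = f (l, a, b, s, t)"
      by (auto simp: less_eq_prod_def zero_prod_def)
    then show "p \<in> technology X Y P Q"
      unfolding technology_def f_def
      by (intro CollectI) (auto simp: less_eq_vec_def intro!: exI[of _ l] exI[of _ a] exI[of _ b])
  qed
  ultimately show ?thesis by blast
qed

lemma convex_cone_technology: "convex_cone (technology X Y P Q)"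
  using technology_eq_linear_image[of X Y P Q] convex_cone_linear_image_orthant(1) by metis

lemma closed_technology: "closed (technology X Y P Q)"
  using technology_eq_linear_image[of X Y P Q] convex_cone_linear_image_orthant(2) by metis

definition free_disposal :: "((real ^ 'm) \<times> (real ^ 's)) set \<Rightarrow> bool"
  where "free_disposal T \<longleftrightarrow> (\<forall>x y x' y'. (x, y) \<in> T \<and> x \<le> x' \<and> y' \<le> y \<longrightarrow> (x', y') \<in> T)"

lemma free_disposalD: "free_disposal T \<Longrightarrow> (x, y) \<in> T \<Longrightarrow> x \<le> x' \<Longrightarrow> y' \<le> y \<Longrightarrow> (x', y') \<in> T"
  unfolding free_disposal_def by blast

lemma free_disposal_technology: "free_disposal (technology X Y P Q)"
  unfolding free_disposal_def technology_def by (blast intro: order_trans)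

section \<open>Supporting prices\<close>

definition no_profit :: "((real ^ 'm) \<times> (real ^ 's)) set \<Rightarrow> real ^ 'm \<Rightarrow> real ^ 's \<Rightarrow> bool"
  where "no_profit T v u \<longleftrightarrow> (\<forall>x y. (x, y) \<in> T \<longrightarrow> u \<bullet> y \<le> v \<bullet> x)"

text \<open>Free disposal fixes the signs of a separating functional: it is nonnegative on all
  \<open>(z, 0)\<close> and \<open>(0, - z)\<close> with \<open>z \<ge> 0\<close>, hence of the form \<open>(v, - u)\<close> with \<open>v, u \<ge> 0\<close>.\<close>

lemma separating_prices:
  fixes T S :: "((real ^ 'm) \<times> (real ^ 's)) set"
  assumes T: "convex_cone T" "free_disposal T"
    and S: "convex S" "S \<noteq> {}" "S \<inter> T = {}"
  obtains v u where "(v, u) \<noteq> 0" "0 \<le> v" "0 \<le> u" "no_profit T v u"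
    "\<And>x y. (x, y) \<in> S \<Longrightarrow> v \<bullet> x \<le> u \<bullet> y"
proof -
  have T0: "0 \<in> T" using T(1) by (rule convex_cone_contains_0)
  have "convex T" using T(1) by (simp add: convex_cone_def)
  then obtain p \<beta> where p: "p \<noteq> 0" "\<forall>q\<in>S. p \<bullet> q \<le> \<beta>" "\<forall>q\<in>T. p \<bullet> q \<ge> \<beta>"
    using separating_hyperplane_sets[OF S(1) _ S(2) _ S(3)] T0 by (metis empty_iff)
  have "\<beta> \<le> 0" using p(3) T0 by force
  \<comment> \<open>A linear function that is bounded below on a cone is nonnegative on it.\<close>
  have pT: "0 \<le> p \<bullet> q" if "q \<in> T" for q
  proof (rule ccontr)
    assume neg: "\<not> 0 \<le> p \<bullet> q"
    define c where "c = (\<beta> - 1) / (p \<bullet> q)"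
    have "0 \<le> c" using neg \<open>\<beta> \<le> 0\<close> by (simp add: c_def divide_nonpos_neg)
    then have "c *\<^sub>R q \<in> T" using T(1) that by (intro convex_cone_scaleR)
    then have "\<beta> \<le> c * (p \<bullet> q)" using p(3) by force
    then show False using neg by (simp add: c_def)
  qed
  obtain v w where vw: "p = (v, w)" by (cases p)
  show ?thesis
  proof (rule that[of v "- w"])
    show "(v, - w) \<noteq> 0" using p(1) vw by (auto simp: zero_prod_def)
    have "(z, 0) \<in> T" if "0 \<le> z" for z
      using free_disposalD[OF T(2), of 0 0 z 0] T0 that by (simp add: zero_prod_def)
    then show "0 \<le> v" using pT vw by (intro nonneg_if_inner_nonneg) force
    have "(0, - z) \<in> T" if "0 \<le> z" for z
      using free_disposalD[OF T(2), of 0 0 0 "- z"] T0 that by (simp add: zero_prod_def)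
    then show "0 \<le> - w" using pT vw by (intro nonneg_if_inner_nonneg) force
    show "no_profit T v (- w)" using pT vw by (force simp: no_profit_def)
    show "v \<bullet> x \<le> - w \<bullet> y" if "(x, y) \<in> S" for x y
      using p(2) that vw \<open>\<beta> \<le> 0\<close> by force
  qed
qed

text \<open>The points that strictly dominate \<open>(x, y)\<close>, which a weakly efficient \<open>(x, y)\<close> keeps out of the
  technology.\<close>

lemma convex_strict_orthant_above:
  fixes x :: "real ^ 'm" and y :: "real ^ 's"
  shows "convex {(x', y'). x' \<lless> x \<and> y \<lless> y'}"
proof -
  have "{(x', y'). x' \<lless> x \<and> y \<lless> y'} = (\<Inter>i. {x'. x' $ i < x $ i}) \<times> (\<Inter>r. {y'. y $ r < y' $ r})"
    by (auto simp: vec_less_def)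
  moreover have "convex {x' :: real ^ 'm. x' $ i < x $ i}" for i
    using convex_halfspace_lt[of "axis i 1 :: real ^ 'm" "x $ i"] by (simp add: inner_axis_one)
  moreover have "convex {y' :: real ^ 's. y $ r < y' $ r}" for r
    using convex_halfspace_gt[of "y $ r" "axis r 1 :: real ^ 's"] by (simp add: inner_axis_one)
  ultimately show ?thesis by (auto intro!: convex_Times convex_INT)
qed

lemma weak_frontier_supporting_prices:
  fixes T :: "((real ^ 'm) \<times> (real ^ 's)) set"
  assumes T: "convex_cone T" "free_disposal T" and xy: "(x, y) \<in> weak_frontier T"
  obtains v u where "(v, u) \<noteq> 0" "0 \<le> v" "0 \<le> u" "no_profit T v u" "v \<bullet> x = u \<bullet> y"
proof -
  let ?S = "{(x', y'). x' \<lless> x \<and> y \<lless> y'}"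
  let ?z = "\<lambda>\<epsilon>. (x - \<epsilon> *\<^sub>R 1, y + \<epsilon> *\<^sub>R 1)"
  have z: "?z \<epsilon> \<in> ?S" if "\<epsilon> > 0" for \<epsilon> using that by (simp add: vec_less_def)
  then have ne: "?S \<noteq> {}" using zero_less_one by blast
  have "?S \<inter> T = {}"
    using xy unfolding weak_frontier_def by (fastforce simp: vec_less_def)
  with separating_prices[OF T convex_strict_orthant_above ne]
  obtain v u where vu: "(v, u) \<noteq> 0" "0 \<le> v" "0 \<le> u" "no_profit T v u"
    and le: "\<And>x' y'. (x', y') \<in> ?S \<Longrightarrow> v \<bullet> x' \<le> u \<bullet> y'" by blast
  \<comment> \<open>The point \<open>(x, y)\<close> is only a limit of strictly dominating points, so the inequality passes to the limit.\<close>
  have "(\<lambda>\<epsilon>. v \<bullet> (x - \<epsilon> *\<^sub>R 1)) \<midarrow>0\<rightarrow> v \<bullet> (x - 0 *\<^sub>R 1)"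
    "(\<lambda>\<epsilon>. u \<bullet> (y + \<epsilon> *\<^sub>R 1)) \<midarrow>0\<rightarrow> u \<bullet> (y + 0 *\<^sub>R 1)"
    by (intro tendsto_intros)+
  then have lim: "((\<lambda>\<epsilon>. v \<bullet> (x - \<epsilon> *\<^sub>R 1)) \<longlongrightarrow> v \<bullet> x) (at_right 0)"
    "((\<lambda>\<epsilon>. u \<bullet> (y + \<epsilon> *\<^sub>R 1)) \<longlongrightarrow> u \<bullet> y) (at_right 0)"
    by (auto intro: tendsto_mono[OF at_le] simp: filterlim_at_split)
  have ev: "\<forall>\<^sub>F \<epsilon> in at_right 0. v \<bullet> (x - \<epsilon> *\<^sub>R 1) \<le> u \<bullet> (y + \<epsilon> *\<^sub>R 1)"
    by (rule eventually_mono[OF eventually_at_right_less[of 0]]) (use le z in blast)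
  have "v \<bullet> x \<le> u \<bullet> y"
    by (rule tendsto_le[OF _ lim(2) lim(1) ev]) simp
  moreover have "u \<bullet> y \<le> v \<bullet> x"
    using vu(4) xy by (simp add: no_profit_def weak_frontier_def)
  ultimately show ?thesis using vu that by force
qed

text \<open>Each condition on the right tests one family of generators of the cone; the sign of \<open>(v, u)\<close>
  takes care of disposal.\<close>

lemma no_profit_technology_iff:
  fixes X :: "'n::finite \<Rightarrow> real ^ 'm" and Y :: "'n \<Rightarrow> real ^ 's"
    and P :: "real ^ 'p ^ 'm" and Q :: "real ^ 'q ^ 's"
  assumes "0 \<le> v" "0 \<le> u"
  shows "no_profit (technology X Y P Q) v u
    \<longleftrightarrow> (\<forall>j. u \<bullet> Y j \<le> v \<bullet> X j) \<and> v v* P \<le> 0 \<and> u v* Q \<le> 0"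
proof
  assume R: "no_profit (technology X Y P Q) v u"
  have mem: "((\<Sum>j\<in>UNIV. (l $ j) *\<^sub>R X j) - P *v a, (\<Sum>j\<in>UNIV. (l $ j) *\<^sub>R Y j) + Q *v b)
      \<in> technology X Y P Q" if "0 \<le> l" "0 \<le> a" "0 \<le> b" for l a b
    unfolding technology_def using that by blast
  have ax: "(\<Sum>j\<in>UNIV. (axis k 1 $ j) *\<^sub>R Z j) = Z k" for k :: 'n and Z :: "'n \<Rightarrow> 'b::real_vector"
    by (simp add: axis_def if_distrib[of "\<lambda>c. c *\<^sub>R _"] cong: if_cong)
  have "u \<bullet> Y j \<le> v \<bullet> X j" for j
    using R mem[of "axis j 1" 0 0] axis_nonneg by (force simp: no_profit_def ax)
  moreover have "(v v* P) $ k \<le> 0" for k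
    using R mem[of 0 "axis k 1" 0] axis_nonneg[of k]
    by (force simp: no_profit_def inner_axis simp flip: dot_lmul_matrix)
  moreover have "(u v* Q) $ k \<le> 0" for k
    using R mem[of 0 0 "axis k 1"] axis_nonneg[of k]
    by (force simp: no_profit_def inner_axis simp flip: dot_lmul_matrix)
  ultimately show "(\<forall>j. u \<bullet> Y j \<le> v \<bullet> X j) \<and> v v* P \<le> 0 \<and> u v* Q \<le> 0"
    by (simp add: less_eq_vec_def)
next
  assume R: "(\<forall>j. u \<bullet> Y j \<le> v \<bullet> X j) \<and> v v* P \<le> 0 \<and> u v* Q \<le> 0"
  show "no_profit (technology X Y P Q) v u"
    unfolding no_profit_def
  proof (intro allI impI)
    fix x y assume "(x, y) \<in> technology X Y P Q"
    then obtain l a b where lab: "0 \<le> l" "0 \<le> a" "0 \<le> b"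
      and x: "(\<Sum>j\<in>UNIV. (l $ j) *\<^sub>R X j) - P *v a \<le> x"
      and y: "y \<le> (\<Sum>j\<in>UNIV. (l $ j) *\<^sub>R Y j) + Q *v b"
      unfolding technology_def by blast
    have "0 \<le> - (v v* P) \<bullet> a" "0 \<le> - (u v* Q) \<bullet> b"
      using R lab by (simp_all only: inner_nonneg neg_0_le_iff_le)
    then have PQ: "v \<bullet> (P *v a) \<le> 0" "u \<bullet> (Q *v b) \<le> 0" by (simp_all flip: dot_lmul_matrix)
    have XY: "(\<Sum>j\<in>UNIV. (l $ j) * (u \<bullet> Y j)) \<le> (\<Sum>j\<in>UNIV. (l $ j) * (v \<bullet> X j))"
      using R lab(1) by (auto intro!: sum_mono mult_left_mono simp: less_eq_vec_def)
    have "0 \<le> u \<bullet> ((\<Sum>j\<in>UNIV. (l $ j) *\<^sub>R Y j) + Q *v b - y)"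
      using assms(2) y by (intro inner_nonneg) simp_all
    moreover have "0 \<le> v \<bullet> (x - ((\<Sum>j\<in>UNIV. (l $ j) *\<^sub>R X j) - P *v a))"
      using assms(1) x by (intro inner_nonneg) simp_all
    ultimately show "u \<bullet> y \<le> v \<bullet> x"
      using PQ XY by (simp add: inner_simps inner_sum_right)
  qed
qed

section \<open>Strictly positive prices and the two frontiers\<close>

text \<open>The conditions on \<open>v\<close> and \<open>u\<close> given by the matrices are separate and homogeneous, so only
  \<open>u \<bullet> Y j \<le> v \<bullet> X j\<close> couples them; as \<open>v \<bullet> X j > 0\<close> for the finitely many \<open>j\<close>, scaling \<open>u\<close> down
  achieves it.\<close>

lemma strictly_positive_no_profit_prices:
  fixes X :: "'n::finite \<Rightarrow> real ^ 'm" and Y :: "'n \<Rightarrow> real ^ 's"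
    and P :: "real ^ 'p ^ 'm" and Q :: "real ^ 'q ^ 's"
  assumes X_pos: "\<And>j. 0 \<lless> X j"
    and v: "0 \<lless> v" "v v* P \<le> 0" and u: "0 \<lless> u" "u v* Q \<le> 0"
  obtains \<epsilon> :: real where "\<epsilon> > 0" "no_profit (technology X Y P Q) v (\<epsilon> *\<^sub>R u)"
proof -
  have "0 < v \<bullet> X j" for j
    using X_pos v(1) by (metis inner_pos vec_less_imp_le vec_less_imp_neq)
  define c where "c = Min (range (\<lambda>j. v \<bullet> X j))"
  \<comment> \<open>Inserting \<open>1\<close> makes the bound positive, so that it can be divided by.\<close>
  define C where "C = Max (insert 1 (range (\<lambda>j. u \<bullet> Y j)))"
  have c: "0 < c" "\<And>j. c \<le> v \<bullet> X j"
    using \<open>\<And>j. 0 < v \<bullet> X j\<close> by (auto simp: c_def)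
  have C: "0 < C" "\<And>j. u \<bullet> Y j \<le> C"
    using order_less_le_trans[OF zero_less_one, of C] by (simp_all add: C_def del: Max_insert)
  show ?thesis
  proof (rule that[of "c / C"])
    show "0 < c / C" using c C by simp
    have "(c / C) *\<^sub>R u \<bullet> Y j \<le> v \<bullet> X j" for j
      using mult_left_mono[OF C(2)[of j], of "c / C"] c(1) C(1) c(2)[of j] by simp
    moreover have "((c / C) *\<^sub>R u) v* Q \<le> 0"
      using u(2) c(1) C(1)
      unfolding scaleR_vector_matrix_assoc by (intro scaleR_nonneg_nonpos) simp_all
    ultimately show "no_profit (technology X Y P Q) v ((c / C) *\<^sub>R u)"
      using v u c(1) C(1)
      by (subst no_profit_technology_iff)
        (auto intro!: scaleR_nonneg_nonneg simp: less_eq_vec_def vec_less_def less_imp_le)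
  qed
qed

text \<open>With free inputs, the positive outputs of an observed unit would earn a profit at any nonzero \<open>u\<close>.\<close>

lemma input_price_nonzero:
  fixes X :: "'n::finite \<Rightarrow> real ^ 'm" and Y :: "'n \<Rightarrow> real ^ 's"
  assumes "\<And>j. 0 \<lless> Y j" "0 \<le> v" "0 \<le> u" "(v, u) \<noteq> 0"
    and R: "no_profit (technology X Y P Q) v u"
  shows "v \<noteq> 0"
proof
  assume "v = 0"
  with assms(4) have "u \<noteq> 0" by (auto simp: zero_prod_def)
  then have "0 < Y j \<bullet> u" for j using inner_pos[of "Y j" u] assms by blast
  moreover have "u \<bullet> Y j \<le> v \<bullet> X j" for j
    using R assms by (simp add: no_profit_technology_iff)
  ultimately show False using \<open>v = 0\<close> by (simp add: inner_commute not_less[symmetric])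
qed

text \<open>The supporting prices cannot value outputs at zero: they would give \<open>v \<bullet> x = 0\<close>, while the same
  \<open>v\<close> together with a small positive output price is still a no-profit pair and forces
  \<open>v \<bullet> x > 0\<close> because \<open>y\<close> is positive.\<close>

lemma weak_frontier_strictly_positive_prices:
  fixes X :: "'n::finite \<Rightarrow> real ^ 'm" and Y :: "'n \<Rightarrow> real ^ 's"
    and P :: "real ^ 'p ^ 'm" and Q :: "real ^ 'q ^ 's"
  assumes data_pos: "\<And>j. 0 \<lless> X j" "\<And>j. 0 \<lless> Y j"
    and P_cond: "{v. 0 \<le> v \<and> v v* P \<le> 0} \<subseteq> {v. 0 \<lless> v} \<union> {0}"
    and Q_ne: "{u. 0 \<le> u \<and> u v* Q \<le> 0 \<and> u \<noteq> 0} \<noteq> {}"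
    and Q_cond: "{u. 0 \<le> u \<and> u v* Q \<le> 0 \<and> u \<noteq> 0} \<subseteq> {u. 0 \<lless> u}"
    and xy: "(x, y) \<in> weak_frontier (technology X Y P Q)" "0 \<lless> y"
  obtains v u where "0 \<lless> v" "0 \<lless> u" "no_profit (technology X Y P Q) v u" "v \<bullet> x = u \<bullet> y"
proof -
  obtain v u where vu: "(v, u) \<noteq> 0" "0 \<le> v" "0 \<le> u" "no_profit (technology X Y P Q) v u"
    "v \<bullet> x = u \<bullet> y"
    using weak_frontier_supporting_prices[OF convex_cone_technology free_disposal_technology xy(1)]
    by blast
  then have vP: "v v* P \<le> 0" and uQ: "u v* Q \<le> 0" by (simp_all add: no_profit_technology_iff)
  have "v \<noteq> 0" using input_price_nonzero[where Y = Y, OF data_pos(2)] vu by blast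
  with P_cond vu vP have v: "0 \<lless> v" by blast
  have "u \<noteq> 0"
  proof
    assume "u = 0"
    obtain u' where u': "0 \<lless> u'" "u' v* Q \<le> 0" using Q_ne Q_cond by blast
    obtain \<epsilon> :: real where \<epsilon>: "\<epsilon> > 0" "no_profit (technology X Y P Q) v (\<epsilon> *\<^sub>R u')"
      using strictly_positive_no_profit_prices[where X = X and Y = Y, OF data_pos(1) v vP u'] by blast
    have "0 < u' \<bullet> y" using u'(1) xy(2) by (metis inner_pos vec_less_imp_le vec_less_imp_neq)
    moreover have "\<epsilon> * (u' \<bullet> y) \<le> v \<bullet> x"
      using \<epsilon>(2) xy(1) by (simp add: no_profit_def weak_frontier_def)
    ultimately show False using \<epsilon>(1) vu(5) \<open>u = 0\<close> by (simp add: mult_le_0_iff)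
  qed
  with Q_cond vu uQ have "0 \<lless> u" by blast
  with v show ?thesis using vu(4,5) by (rule that)
qed

text \<open>Any feasible improvement in even one component would earn a profit at strictly positive prices.\<close>

lemma strong_frontierI:
  assumes "0 \<lless> v" "0 \<lless> u" "no_profit T v u" "v \<bullet> x = u \<bullet> y" "(x, y) \<in> T"
  shows "(x, y) \<in> strong_frontier T"
proof -
  have "(x', y') \<notin> T" if "(x', - y') \<le> (x, - y)" "(x', - y') \<noteq> (x, - y)" for x' y'
  proof
    assume T: "(x', y') \<in> T"
    have le: "x' \<le> x" "y \<le> y'" and ne: "x' \<noteq> x \<or> y' \<noteq> y" using that by auto
    have "0 \<le> v \<bullet> (x - x')" "0 \<le> u \<bullet> (y' - y)"
      using assms le by (simp_all add: inner_nonneg vec_less_imp_le)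
    moreover have "0 < v \<bullet> (x - x') \<or> 0 < u \<bullet> (y' - y)"
      using inner_pos[of v "x - x'"] inner_pos[of u "y' - y"] assms le ne by auto
    moreover have "u \<bullet> y' \<le> v \<bullet> x'" using T assms by (simp add: no_profit_def)
    ultimately show False using assms(4) by (auto simp: inner_diff_right)
  qed
  with assms(5) show ?thesis unfolding strong_frontier_def by blast
qed

lemma strong_frontier_subset_weak: "strong_frontier T \<subseteq> weak_frontier T"
proof clarify
  fix x y assume *: "(x, y) \<in> strong_frontier T"
  have "(x', y') \<notin> T" if "x' \<lless> x" "- y' \<lless> - y" for x' y'
    using * vec_less_imp_le[OF that(1)] vec_less_imp_le[OF that(2)] vec_less_imp_neq[OF that(1)]
    unfolding strong_frontier_def by auto
  with * show "(x, y) \<in> weak_frontier T"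
    by (auto simp: strong_frontier_def weak_frontier_def)
qed

text \<open>A point outside the technology could be separated from it, and the input part of the separating
  prices would be an excluded \<open>v\<close>.\<close>

lemma technology_eq_UNIV:
  fixes X :: "'n::finite \<Rightarrow> real ^ 'm" and Y :: "'n \<Rightarrow> real ^ 's"
    and P :: "real ^ 'p ^ 'm" and Q :: "real ^ 'q ^ 's"
  assumes "\<And>j. 0 \<lless> Y j" and none: "\<not> (\<exists>v. 0 \<le> v \<and> v v* P \<le> 0 \<and> v \<noteq> 0)"
  shows "technology X Y P Q = UNIV"
proof (rule ccontr)
  assume "technology X Y P Q \<noteq> UNIV"
  then obtain p where "{p} \<inter> technology X Y P Q = {}" by blast
  then obtain v u where vu: "(v, u) \<noteq> 0" "0 \<le> v" "0 \<le> u" "no_profit (technology X Y P Q) v u"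
    by (rule separating_prices[OF convex_cone_technology free_disposal_technology
          convex_singleton insert_not_empty]) blast
  have "v \<noteq> 0" by (rule input_price_nonzero[OF assms(1) vu(2,3,1,4)])
  moreover have "v v* P \<le> 0" using vu by (simp add: no_profit_technology_iff)
  ultimately show False using none vu(2) by blast
qed

section \<open>Least slacks on one side\<close>

text \<open>The common shape of the input and the output side: \<open>S\<close> is the set of slacks that stay
  feasible, \<open>A\<close> the set of nonnegative slacks that end on the weak frontier, and \<open>z\<close> the point relative to
  which slacks are measured. The premises \<open>bounded\<close> and \<open>A_max\<close> carry the prices: \<open>w\<close> is the price
  vector of the side in question.\<close>

locale slack_region =
  fixes S A :: "(real ^ 'k) set" and z :: "real ^ 'k"
  assumes closed_S: "closed S" and zero_mem: "0 \<in> S"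
    and down: "\<And>d d'. d \<in> S \<Longrightarrow> d' \<le> d \<Longrightarrow> d' \<in> S"
    and z_pos: "0 \<lless> z"
    and bounded: "\<exists>w c. 0 \<lless> w \<and> (\<forall>d\<in>S. w \<bullet> d \<le> c)"
    and A_max: "\<And>d. d \<in> A \<Longrightarrow> 0 \<le> d \<and> (\<exists>w. 0 \<lless> w \<and> (\<forall>d'\<in>S. w \<bullet> d' \<le> w \<bullet> d))"
    and A_intro: "\<And>d. d \<in> S \<Longrightarrow> 0 \<le> d \<Longrightarrow> (\<And>d'. d' \<in> S \<Longrightarrow> \<not> d \<lless> d') \<Longrightarrow> d \<in> A"
begin

definition steps :: "'k \<Rightarrow> real set"
  where "steps i = {\<delta>. (\<delta> * z $ i) *\<^sub>R axis i 1 \<in> S}"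

lemma z_pos_nth: "0 < z $ i"
  using z_pos by (simp add: vec_less_def)

lemma has_max_steps: "has_max (steps i)"
proof -
  obtain w c where w: "0 \<lless> w" "\<And>d. d \<in> S \<Longrightarrow> w \<bullet> d \<le> c" using bounded by blast
  have wz: "0 < w $ i * z $ i" using w(1) z_pos by (simp add: vec_less_def)
  have "\<delta> \<le> c / (w $ i * z $ i)" if "\<delta> \<in> steps i" for \<delta>
    using w(2)[of "(\<delta> * z $ i) *\<^sub>R axis i 1"] that wz
    by (simp add: steps_def inner_axis field_simps)
  then have "bdd_above (steps i)" by (meson bdd_aboveI)
  moreover have "closed (steps i)"
  proof -
    have "closed ((\<lambda>\<delta>. (\<delta> * z $ i) *\<^sub>R axis i 1) -` S)"
      by (intro continuous_closed_vimage closed_S) (auto intro!: continuous_intros)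
    then show ?thesis by (simp add: steps_def vimage_def)
  qed
  moreover have "steps i \<noteq> {}"
    using zero_mem by (auto simp: steps_def intro!: exI[of _ 0])
  ultimately show ?thesis
    unfolding has_max_def by (meson closed_contains_Sup cSup_upper)
qed

definition max_step :: "'k \<Rightarrow> real"
  where "max_step i = (SOME \<delta>. \<delta> \<in> steps i \<and> (\<forall>\<delta>'\<in>steps i. \<delta>' \<le> \<delta>))"

lemma max_step: "max_step i \<in> steps i" "\<delta> \<in> steps i \<Longrightarrow> \<delta> \<le> max_step i"
proof -
  have "\<exists>\<delta>. \<delta> \<in> steps i \<and> (\<forall>\<delta>'\<in>steps i. \<delta>' \<le> \<delta>)" using has_max_steps by (auto simp: has_max_def)
  from someI_ex[OF this] show "max_step i \<in> steps i" "\<delta> \<in> steps i \<Longrightarrow> \<delta> \<le> max_step i"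
    unfolding max_step_def by blast+
qed

lemma max_step_nonneg: "0 \<le> max_step i"
  using max_step(2)[of 0 i] zero_mem by (simp add: steps_def)

lemma SUP_steps: "(SUP \<delta>\<in>steps i. ereal \<delta>) = ereal (max_step i)"
  by (rule SUP_eqI) (auto simp: max_step)

text \<open>A feasible slack strictly above the longest step along one axis would, by downward
  closure, make a longer step along that axis feasible.\<close>

lemma axis_slack_mem: "(max_step i * z $ i) *\<^sub>R axis i 1 \<in> A"
proof (rule A_intro)
  show "(max_step i * z $ i) *\<^sub>R axis i 1 \<in> S" using max_step(1)[of i] by (simp add: steps_def)
  show "0 \<le> (max_step i * z $ i) *\<^sub>R (axis i 1 :: real ^ 'k)"
    using max_step_nonneg[of i] z_pos_nth[of i] by (intro scaleR_nonneg_nonneg axis_nonneg) simp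
next
  fix d assume d: "d \<in> S"
  show "\<not> (max_step i * z $ i) *\<^sub>R axis i 1 \<lless> d"
  proof
    assume "(max_step i * z $ i) *\<^sub>R axis i 1 \<lless> d"
    then have gt: "((max_step i * z $ i) *\<^sub>R axis i 1) $ k < d $ k" for k
      by (simp add: vec_less_def)
    have "((d $ i / z $ i) * z $ i) *\<^sub>R axis i 1 \<le> d"
      unfolding less_eq_vec_def
    proof
      fix k show "(((d $ i / z $ i) * z $ i) *\<^sub>R axis i 1) $ k \<le> d $ k"
        using gt[of k] z_pos_nth[of i] by (cases "k = i") (auto simp: axis_def)
    qed
    with d have "d $ i / z $ i \<in> steps i" using down by (auto simp: steps_def)
    then have "d $ i / z $ i \<le> max_step i" by (rule max_step)
    then show False using gt[of i] z_pos_nth[of i] by (simp add: field_simps)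
  qed
qed

lemma rel_size_axis_slack: "rel_size z ((max_step i * z $ i) *\<^sub>R axis i 1) = max_step i"
proof -
  have "rel_size z ((max_step i * z $ i) *\<^sub>R axis i 1) = (\<Sum>k\<in>UNIV. if k = i then max_step i else 0)"
    unfolding rel_size_def using z_pos_nth[of i]
    by (intro sum.cong) (auto simp: axis_def)
  then show ?thesis by simp
qed

text \<open>The axis to compare with is the one on which a unit of relative slack is worth most at the prices
  that support \<open>d\<close>: no slack gains value faster per unit of relative size.\<close>

lemma max_step_le_rel_size:
  assumes "d \<in> A"
  shows "\<exists>i. max_step i \<le> rel_size z d"
proof -
  obtain w where d: "0 \<le> d" and w: "0 \<lless> w" "\<And>d'. d' \<in> S \<Longrightarrow> w \<bullet> d' \<le> w \<bullet> d"
    using A_max[OF assms] by blast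
  let ?g = "\<lambda>k. w $ k * z $ k"
  have "Max (range ?g) \<in> range ?g" by (rule Max_in) auto
  then obtain i where "?g i = Max (range ?g)" by fastforce
  then have i: "?g k \<le> ?g i" for k by simp
  have "max_step i * ?g i = w \<bullet> ((max_step i * z $ i) *\<^sub>R axis i 1)"
    by (simp add: inner_axis)
  also have "\<dots> \<le> w \<bullet> d" using w(2) max_step(1)[of i] unfolding steps_def by blast
  also have "\<dots> = (\<Sum>k\<in>UNIV. ?g k * (d $ k / z $ k))"
    using z_pos_nth unfolding inner_vec_def by (intro sum.cong) (auto simp: less_imp_neq[symmetric])
  also have "\<dots> \<le> (\<Sum>k\<in>UNIV. ?g i * (d $ k / z $ k))"
    using d z_pos_nth i
    by (intro sum_mono mult_right_mono) (auto simp: less_eq_vec_def less_imp_le)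
  also have "\<dots> = rel_size z d * ?g i" by (simp add: rel_size_def sum_distrib_left mult.commute)
  finally have "max_step i \<le> rel_size z d"
    using w(1) z_pos_nth[of i] by (simp add: vec_less_def)
  then show ?thesis by blast
qed

lemma Min_max_step_eq: "\<exists>i. Min (range max_step) = max_step i"
proof -
  have "Min (range max_step) \<in> range max_step" by (rule Min_in) auto
  then show ?thesis by blast
qed

lemma Min_max_step_le: "d \<in> A \<Longrightarrow> Min (range max_step) \<le> rel_size z d"
  using max_step_le_rel_size[of d] by (meson Min_le finite finite_imageI order_trans rangeI)

lemma attains_min_rel_size: "attains_min (rel_size z) A"
  using Min_max_step_eq Min_max_step_le axis_slack_mem rel_size_axis_slack
  unfolding attains_min_def by metis

lemma INF_rel_size:
  "(INF d\<in>A. ereal (rel_size z d)) = Min (range (\<lambda>i. SUP \<delta>\<in>steps i. ereal \<delta>))"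
proof -
  have "(INF d\<in>A. ereal (rel_size z d)) = ereal (Min (range max_step))"
    using Min_max_step_eq Min_max_step_le axis_slack_mem rel_size_axis_slack
    by (intro INF_eqI) (auto, metis ereal_less_eq(3))
  also have "\<dots> = Min (range (\<lambda>i. ereal (max_step i)))"
    using mono_Min_commute[of ereal "range max_step"] by (simp add: mono_def image_image)
  finally show ?thesis by (simp add: SUP_steps)
qed

end

section \<open>Input and output distances\<close>

lemma slack_region_input:
  fixes T :: "((real ^ 'm) \<times> (real ^ 's)) set"
  assumes T: "closed T" "free_disposal T" and xy: "(x, y) \<in> T" "0 \<lless> x"
    and pr: "0 \<lless> v" "no_profit T v u"
    and frontier: "\<And>x'. (x', y) \<in> weak_frontier T \<Longrightarrow>
      \<exists>v u. 0 \<lless> v \<and> no_profit T v u \<and> v \<bullet> x' = u \<bullet> y"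
  shows "slack_region {d. (x - d, y) \<in> T} (input_slacks (weak_frontier T) x y) x"
proof
  have "closed ((\<lambda>d. (x - d, y)) -` T)"
    by (intro continuous_closed_vimage T) (auto intro!: continuous_intros)
  then show "closed {d. (x - d, y) \<in> T}" by (simp add: vimage_def)
  show "0 \<in> {d. (x - d, y) \<in> T}" using xy by simp
  show "d' \<in> {d. (x - d, y) \<in> T}" if "d \<in> {d. (x - d, y) \<in> T}" "d' \<le> d" for d d'
    using free_disposalD[OF T(2), of "x - d" y "x - d'" y] that by (simp add: diff_left_mono)
  show "0 \<lless> x" by fact
  show "\<exists>w c. 0 \<lless> w \<and> (\<forall>d\<in>{d. (x - d, y) \<in> T}. w \<bullet> d \<le> c)"
  proof (intro exI conjI ballI)
    show "0 \<lless> v" by fact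
    fix d assume "d \<in> {d. (x - d, y) \<in> T}"
    then have "u \<bullet> y \<le> v \<bullet> (x - d)" using pr(2) by (simp add: no_profit_def)
    then show "v \<bullet> d \<le> v \<bullet> x - u \<bullet> y" by (simp add: inner_diff_right)
  qed
next
  fix d assume "d \<in> input_slacks (weak_frontier T) x y"
  then have d: "(x - d, y) \<in> weak_frontier T" "0 \<le> d" by (simp_all add: input_slacks_def)
  obtain v u where vu: "0 \<lless> v" "no_profit T v u" "v \<bullet> (x - d) = u \<bullet> y"
    using frontier[OF d(1)] by blast
  have "v \<bullet> d' \<le> v \<bullet> d" if "(x - d', y) \<in> T" for d'
  proof -
    have "u \<bullet> y \<le> v \<bullet> (x - d')" using vu(2) that by (simp add: no_profit_def)
    then show ?thesis using vu(3) by (simp add: inner_diff_right)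
  qed
  with d vu show "0 \<le> d \<and> (\<exists>w. 0 \<lless> w \<and> (\<forall>d'\<in>{d. (x - d, y) \<in> T}. w \<bullet> d' \<le> w \<bullet> d))"
    by blast
next
  fix d assume d: "d \<in> {d. (x - d, y) \<in> T}" "0 \<le> d"
    and max: "\<And>d'. d' \<in> {d. (x - d, y) \<in> T} \<Longrightarrow> \<not> d \<lless> d'"
  have "(x', y') \<notin> T" if "x' \<lless> x - d" "- y' \<lless> - y" for x' y'
  proof
    assume "(x', y') \<in> T"
    then have "(x', y) \<in> T"
      using free_disposalD[OF T(2), of x' y' x' y] vec_less_imp_le[OF that(2)] by simp
    then have "\<not> d \<lless> x - x'" by (intro max) simp
    then show False using that(1) by (auto simp: vec_less_def algebra_simps)
  qed
  with d show "d \<in> input_slacks (weak_frontier T) x y"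
    by (simp add: input_slacks_def weak_frontier_def)
qed

lemma slack_region_output:
  fixes T :: "((real ^ 'm) \<times> (real ^ 's)) set"
  assumes T: "closed T" "free_disposal T" and xy: "(x, y) \<in> T" "0 \<lless> y"
    and pr: "0 \<lless> u" "no_profit T v u"
    and frontier: "\<And>y'. (x, y') \<in> weak_frontier T \<Longrightarrow> y \<le> y' \<Longrightarrow>
      \<exists>v u. 0 \<lless> u \<and> no_profit T v u \<and> v \<bullet> x = u \<bullet> y'"
  shows "slack_region {d. (x, y + d) \<in> T} (output_slacks (weak_frontier T) x y) y"
proof
  have "closed ((\<lambda>d. (x, y + d)) -` T)"
    by (intro continuous_closed_vimage T) (auto intro!: continuous_intros)
  then show "closed {d. (x, y + d) \<in> T}" by (simp add: vimage_def)
  show "0 \<in> {d. (x, y + d) \<in> T}" using xy by simp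
  show "d' \<in> {d. (x, y + d) \<in> T}" if "d \<in> {d. (x, y + d) \<in> T}" "d' \<le> d" for d d'
    using free_disposalD[OF T(2), of x "y + d" x "y + d'"] that by simp
  show "0 \<lless> y" by fact
  show "\<exists>w c. 0 \<lless> w \<and> (\<forall>d\<in>{d. (x, y + d) \<in> T}. w \<bullet> d \<le> c)"
  proof (intro exI conjI ballI)
    show "0 \<lless> u" by fact
    fix d assume "d \<in> {d. (x, y + d) \<in> T}"
    then have "u \<bullet> (y + d) \<le> v \<bullet> x" using pr(2) by (simp add: no_profit_def)
    then show "u \<bullet> d \<le> v \<bullet> x - u \<bullet> y" by (simp add: inner_add_right)
  qed
next
  fix d assume "d \<in> output_slacks (weak_frontier T) x y"
  then have d: "(x, y + d) \<in> weak_frontier T" "0 \<le> d" by (simp_all add: output_slacks_def)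
  obtain v u where vu: "0 \<lless> u" "no_profit T v u" "v \<bullet> x = u \<bullet> (y + d)"
    using frontier[OF d(1)] d(2) by auto
  have "u \<bullet> d' \<le> u \<bullet> d" if "(x, y + d') \<in> T" for d'
  proof -
    have "u \<bullet> (y + d') \<le> v \<bullet> x" using vu(2) that by (simp add: no_profit_def)
    then show ?thesis using vu(3) by (simp add: inner_add_right)
  qed
  with d vu show "0 \<le> d \<and> (\<exists>w. 0 \<lless> w \<and> (\<forall>d'\<in>{d. (x, y + d) \<in> T}. w \<bullet> d' \<le> w \<bullet> d))"
    by blast
next
  fix d assume d: "d \<in> {d. (x, y + d) \<in> T}" "0 \<le> d"
    and max: "\<And>d'. d' \<in> {d. (x, y + d) \<in> T} \<Longrightarrow> \<not> d \<lless> d'"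
  have "(x', y') \<notin> T" if "x' \<lless> x" "- y' \<lless> - (y + d)" for x' y'
  proof
    assume "(x', y') \<in> T"
    then have "(x, y') \<in> T"
      using free_disposalD[OF T(2), of x' y' x y'] vec_less_imp_le[OF that(1)] by simp
    then have "\<not> d \<lless> y' - y" by (intro max) simp
    then show False using that(2) by (auto simp: vec_less_def algebra_simps)
  qed
  with d show "d \<in> output_slacks (weak_frontier T) x y"
    by (simp add: output_slacks_def weak_frontier_def)
qed

lemma weak_frontier_UNIV: "weak_frontier (UNIV :: ((real ^ 'm) \<times> (real ^ 's)) set) = {}"
proof -
  have "\<exists>x'. x' \<lless> x" for x :: "real ^ 'k"
    by (rule exI[of _ "x - 1"]) (simp add: vec_less_def)
  note ex = this
  have "(x, y) \<notin> weak_frontier UNIV" for x :: "real ^ 'm" and y :: "real ^ 's"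
  proof -
    obtain x' y' where "x' \<lless> x" "y' \<lless> - y" using ex by metis
    then have "x' \<lless> x \<and> - (- y') \<lless> - y" by simp
    then show ?thesis unfolding weak_frontier_def by blast
  qed
  then show ?thesis by auto
qed

lemma SUP_ereal_UNIV: "(SUP \<delta>\<in>UNIV. ereal \<delta>) = \<infinity>"
  by (rule SUP_PInfty) (metis UNIV_I order_refl)

theorem lemma4:
  fixes X :: "'n::finite \<Rightarrow> real ^ 'm" and Y :: "'n \<Rightarrow> real ^ 's"
    and P :: "real ^ 'p ^ 'm" and Q :: "real ^ 'q ^ 's"
    and x :: "real ^ 'm" and y :: "real ^ 's"
    and T :: "((real ^ 'm) \<times> (real ^ 's)) set"
  assumes T_def: "T = technology X Y P Q"
    and data_pos: "\<And>j. 0 \<lless> X j" "\<And>j. 0 \<lless> Y j"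
    and P_cond: "{v. 0 \<le> v \<and> v v* P \<le> 0} \<subseteq> {v. 0 \<lless> v} \<union> {0}"
    and Q_ne: "{u. 0 \<le> u \<and> u v* Q \<le> 0 \<and> u \<noteq> 0} \<noteq> {}"
    and Q_cond: "{u. 0 \<le> u \<and> u v* Q \<le> 0 \<and> u \<noteq> 0} \<subseteq> {u. 0 \<lless> u}"
    and xy: "(x, y) \<in> T" "0 \<lless> x" "0 \<lless> y"
  shows
    "D_minus T x y = min_input_distance (weak_frontier T) x y \<and>
     min_input_distance (weak_frontier T) x y
       = Min (range (\<lambda>i. SUP \<delta>\<in>input_steps T x y i. ereal \<delta>)) \<and>
     D_plus T x y = min_output_distance (weak_frontier T) x y \<and>
     min_output_distance (weak_frontier T) x y
       = Min (range (\<lambda>r. SUP \<delta>\<in>output_steps T x y r. ereal \<delta>)) \<and>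
     ((\<exists>v. 0 \<le> v \<and> v v* P \<le> 0 \<and> v \<noteq> 0) \<longrightarrow>
        attains_min (rel_size x) (input_slacks (strong_frontier T) x y) \<and>
        attains_min (rel_size x) (input_slacks (weak_frontier T) x y) \<and>
        (\<forall>i. has_max (input_steps T x y i)) \<and>
        attains_min (rel_size y) (output_slacks (strong_frontier T) x y) \<and>
        attains_min (rel_size y) (output_slacks (weak_frontier T) x y) \<and>
        (\<forall>r. has_max (output_steps T x y r)))"
proof -
  have T: "closed T" "free_disposal T"
    by (simp_all add: T_def closed_technology free_disposal_technology)
  have prices: "\<exists>v u. 0 \<lless> v \<and> 0 \<lless> u \<and> no_profit T v u \<and> v \<bullet> x' = u \<bullet> y'"
    if "(x', y') \<in> weak_frontier T" "0 \<lless> y'" for x' y'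
    using weak_frontier_strictly_positive_prices[where X = X and Y = Y and x = x' and y = y',
        OF data_pos P_cond Q_ne Q_cond] that
    unfolding T_def by blast
  have frontier_iff: "(x', y') \<in> strong_frontier T \<longleftrightarrow> (x', y') \<in> weak_frontier T"
    if "0 \<lless> y'" for x' y'
  proof
    assume weak: "(x', y') \<in> weak_frontier T"
    then have "(x', y') \<in> T" by (simp add: weak_frontier_def)
    with prices[OF weak that] show "(x', y') \<in> strong_frontier T"
      by (blast intro: strong_frontierI)
  qed (use strong_frontier_subset_weak in blast)
  have input_eq: "input_slacks (strong_frontier T) x y = input_slacks (weak_frontier T) x y"
    using frontier_iff xy by (simp add: input_slacks_def)
  have output_eq: "output_slacks (strong_frontier T) x y = output_slacks (weak_frontier T) x y"
  proof -
    have "0 \<lless> y + d" if "0 \<le> d" for d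
      using vec_less_le_trans[OF xy(3)] that by simp
    then show ?thesis using frontier_iff unfolding output_slacks_def by blast
  qed
  show ?thesis
  proof (cases "\<exists>v. 0 \<le> v \<and> v v* P \<le> 0 \<and> v \<noteq> 0")
    case True
    then obtain v where v: "0 \<lless> v" "v v* P \<le> 0" using P_cond by blast
    obtain u where u: "0 \<lless> u" "u v* Q \<le> 0" using Q_ne Q_cond by blast
    obtain \<epsilon> :: real where "\<epsilon> > 0" and np: "no_profit T v (\<epsilon> *\<^sub>R u)"
      using strictly_positive_no_profit_prices[where X = X and Y = Y, OF data_pos(1) v u]
      unfolding T_def by blast
    then have \<epsilon>u: "0 \<lless> \<epsilon> *\<^sub>R u" using u(1) by (simp add: vec_less_def)
    interpret inp: slack_region "{d. (x - d, y) \<in> T}" "input_slacks (weak_frontier T) x y" x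
      by (rule slack_region_input[OF T xy(1,2) v(1) np]) (use prices xy in blast)
    interpret outp: slack_region "{d. (x, y + d) \<in> T}" "output_slacks (weak_frontier T) x y" y
      by (rule slack_region_output[OF T xy(1,3) \<epsilon>u np])
        (use prices vec_less_le_trans[OF xy(3)] in blast)
    have "inp.steps = input_steps T x y" "outp.steps = output_steps T x y"
      by (auto simp: fun_eq_iff inp.steps_def outp.steps_def input_steps_def output_steps_def)
    then show ?thesis
      using inp.INF_rel_size outp.INF_rel_size inp.attains_min_rel_size
        outp.attains_min_rel_size inp.has_max_steps outp.has_max_steps
      by (simp add: D_minus_def D_plus_def min_input_distance_def min_output_distance_def
          input_eq output_eq)
  next
    case False
    then have "T = UNIV" using technology_eq_UNIV[OF data_pos(2)] by (simp add: T_def)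
    then have weak: "weak_frontier T = {}"
      and steps: "input_steps T x y = (\<lambda>i. UNIV)" "output_steps T x y = (\<lambda>r. UNIV)"
      by (auto simp: weak_frontier_UNIV input_steps_def output_steps_def)
    have strong: "strong_frontier T = {}" using weak strong_frontier_subset_weak[of T] by simp
    have inf: "Min (range (\<lambda>i. SUP \<delta>\<in>input_steps T x y i. ereal \<delta>)) = \<infinity>"
      "Min (range (\<lambda>r. SUP \<delta>\<in>output_steps T x y r. ereal \<delta>)) = \<infinity>"
      unfolding steps SUP_ereal_UNIV by simp_all
    have "min_input_distance {} x y = \<infinity>" "min_output_distance {} x y = \<infinity>"
      by (simp_all add: min_input_distance_def min_output_distance_def
          input_slacks_def output_slacks_def top_ereal_def)
    with inf show ?thesis
      using False unfolding D_minus_def D_plus_def weak strong by metis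
  qed
qed

end
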